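(* Let $1\le p<\infty$, let $E\subset\mathbb R$ be a Lebesgue measurable set, let $J$ be a nonempty finite or countable set, and let $(\omega_j)_{j\in J}$ be a family of measurable functions from $E$ into $(0,\infty)$. Let $h$ be a measurable ($\mathbb K$-valued, $\mathbb K=\mathbb R$ or $\mathbb C$) function on $E$. Assume that there exists $j_0\in J$ such that $|h|^p\omega_{j_0}\in L^1(E)$. For $s\in E$, set $$\Theta_p(s)=\begin{cases}\displaystyle\inf_{j\in J}\omega_j(s), & p=1,\\[2mm] \displaystyle\Bigl(\sum_{j\in J}\omega_j(s)^{-1/(p-1)}\Bigr)^{1-p}, & 1<p<\infty,\end{cases}$$ where $(+\infty)^{1-p}=0$ when $1<p<\infty$. Then the function $\Theta_p$ is measurable. Moreover, for every $\delta>0$, there exist measurable functions $v_j:E\to[0,\infty)$, $j\in J$, such that $$\sum_{j\in J}v_j(s)=1\quad\text{for every }s\in E,$$ and $$\int_E|h(s)|^p\sum_{j\in J}|v_j(s)|^p\omega_j(s)\,ds\le\int_E|h(s)|^p\Theta_p(s)\,ds+\delta.$$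
   Context: Measurability and integrals are with respect to Lebesgue measure on $\mathbb R$; the sum $\sum_{j\in J}\omega_j(s)^{-1/(p-1)}$ is taken in $[0,+\infty]$. *)

theory Defs
  imports "HOL-Analysis.Analysis"
begin

text \<open>
  The sum is taken in \<open>[0,\<infinity>]\<close>, where it always exists. For nonempty \<open>J\<close> and positive
  weights the infimum is one of a nonempty set bounded below, and the sum is positive,
  so \<open>powr\<close> is only applied to positive reals.
\<close>

definition Theta :: "real \<Rightarrow> 'j set \<Rightarrow> ('j \<Rightarrow> real \<Rightarrow> real) \<Rightarrow> real \<Rightarrow> real" where
  "Theta p J \<omega> s =
    (if p = 1 then (INF j\<in>J. \<omega> j s)
     else let S = (\<Sum>\<^sub>\<infinity>j\<in>J. ennreal (\<omega> j s powr (- 1 / (p - 1))))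
          in if S = \<infinity> then 0 else enn2real S powr (1 - p))"

end

theory Submission
  imports Defs
begin

text \<open>
  For a finite set of indices the optimal weights are explicit (for \<open>p > 1\<close> they are the
  equality case of Hoelder's inequality, for \<open>p = 1\<close> they are spread evenly over the minimisers),
  and they attain the value \<open>Theta p F \<omega>\<close> exactly. Along finite sets \<open>F\<close> exhausting \<open>J\<close> and
  containing \<open>j\<^sub>0\<close>, the functions \<open>Theta p F \<omega>\<close> converge pointwise to \<open>Theta p J \<omega>\<close> and are
  dominated by \<open>\<omega> j\<^sub>0\<close>. By dominated convergence a sufficiently large \<open>F\<close> costs at most \<open>\<delta>\<close>.
\<close>

section \<open>Bounds and measurability of \<open>Theta\<close>\<close>

lemma Theta_one: "Theta 1 J \<omega> s = (INF j\<in>J. \<omega> j s)"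
  by (simp add: Theta_def)

lemma Theta_finite:
  assumes "finite F" "p \<noteq> 1"
  shows "Theta p F \<omega> s = (\<Sum>j\<in>F. \<omega> j s powr (- 1 / (p - 1))) powr (1 - p)"
proof -
  have "(\<Sum>\<^sub>\<infinity>j\<in>F. ennreal (\<omega> j s powr (- 1 / (p - 1))))
      = ennreal (\<Sum>j\<in>F. \<omega> j s powr (- 1 / (p - 1)))"
    using assms by (simp add: sum_ennreal)
  moreover have "0 \<le> (\<Sum>j\<in>F. \<omega> j s powr (- 1 / (p - 1)))"
    by (intro sum_nonneg) simp
  ultimately show ?thesis
    using assms(2) by (simp add: Theta_def Let_def)
qed

text \<open>For p > 1 the sum is at least its k-th summand, and the exponent \<open>1 - p\<close> is
  negative, so dropping the other summands increases the power. The bound yields the dominating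
  function later on.\<close>

lemma Theta_finite_le:
  assumes "1 \<le> p" "finite F" "k \<in> F" "\<And>j. j \<in> F \<Longrightarrow> 0 < \<omega> j s"
  shows "Theta p F \<omega> s \<le> \<omega> k s"
proof (cases "p = 1")
  case True
  have "(INF j\<in>F. \<omega> j s) \<le> \<omega> k s"
    using assms by (intro cINF_lower bdd_below_finite) auto
  then show ?thesis
    using True by (simp add: Theta_one)
next
  case False
  have "(\<Sum>j\<in>F. \<omega> j s powr (- 1 / (p - 1))) powr (1 - p) \<le> (\<omega> k s powr (- 1 / (p - 1))) powr (1 - p)"
    using assms(1-3) assms(4)[OF assms(3)] by (intro powr_mono2' member_le_sum) auto
  \<comment> \<open>The exponents multiply to 1 because
    \<open>(- 1 / (p - 1)) * (1 - p) = 1\<close>.\<close>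
  also have "\<dots> = \<omega> k s powr 1"
    unfolding powr_powr using False by (intro arg_cong2[where f = "(powr)"]) (auto simp: field_simps)
  also have "\<dots> = \<omega> k s"
    using assms(4)[OF assms(3)] by simp
  finally show ?thesis
    using assms False by (simp add: Theta_finite)
qed

lemma Theta_nonneg:
  assumes "J \<noteq> {}" "\<And>j. j \<in> J \<Longrightarrow> 0 < \<omega> j s"
  shows "0 \<le> Theta p J \<omega> s"
proof (cases "p = 1")
  case True
  then show ?thesis
    using assms by (auto simp: Theta_one intro: cINF_greatest less_imp_le)
next
  case False
  then show ?thesis
    by (simp add: Theta_def Let_def)
qed

lemma Theta_measurable_finite:
  assumes "finite F" "\<And>j. j \<in> F \<Longrightarrow> \<omega> j \<in> borel_measurable M"
  shows "Theta p F \<omega> \<in> borel_measurable M"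
proof (cases "p = 1")
  case True
  have "(\<lambda>s. INF j\<in>F. \<omega> j s) \<in> borel_measurable M"
    using assms by (intro borel_measurable_cINF_real) (auto simp: countable_finite)
  then show ?thesis
    using True by (simp add: Theta_one[abs_def])
next
  case False
  have [measurable]: "\<omega> j \<in> borel_measurable M" if "j \<in> F" for j
    using assms that by auto
  have "(\<lambda>s. (\<Sum>j\<in>F. \<omega> j s powr (- 1 / (p - 1))) powr (1 - p)) \<in> borel_measurable M"
    by measurable
  then show ?thesis
    using Theta_finite[OF assms(1) False] by (simp cong: measurable_cong)
qed

section \<open>Limits along finite index sets\<close>

text \<open>For p > 1 the finite partial sums converge in [0, \<infinity>] to a nonzero limit, and x
  \<mapsto> x^(1-p), with value 0 at infinity, is continuous on (0, \<infinity>]. For p = 1 both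
  halves of the order criterion are checked with a single index.\<close>

lemma tendsto_Theta_finite_subsets:
  assumes "1 \<le> p" "J \<noteq> {}" "\<And>j. j \<in> J \<Longrightarrow> 0 < \<omega> j s"
  shows "((\<lambda>F. Theta p F \<omega> s) \<longlongrightarrow> Theta p J \<omega> s) (finite_subsets_at_top J)"
proof (cases "p = 1")
  case True
  have bdd: "bdd_below ((\<lambda>j. \<omega> j s) ` J)"
    using assms(3) by (intro bdd_belowI[of _ 0]) (auto intro: less_imp_le)
  obtain j where j: "j \<in> J" using assms(2) by auto
  show ?thesis
  proof (rule order_tendstoI)
    fix a assume a: "a < Theta p J \<omega> s"
    show "\<forall>\<^sub>F F in finite_subsets_at_top J. a < Theta p F \<omega> s"
      unfolding eventually_finite_subsets_at_top
    \<comment> \<open>Requiring j in F only serves to make F nonempty, so that its infimum is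
      bounded below by the one over J.\<close>
    proof (intro exI[of _ "{j}"] conjI allI impI)
      fix F assume "finite F \<and> {j} \<subseteq> F \<and> F \<subseteq> J"
      then have "(INF j\<in>J. \<omega> j s) \<le> (INF j\<in>F. \<omega> j s)"
        by (intro cINF_superset_mono bdd) auto
      with a show "a < Theta p F \<omega> s"
        using True by (simp add: Theta_one)
    qed (use j in auto)
  next
    fix a assume "Theta p J \<omega> s < a"
    then obtain k where k: "k \<in> J" "\<omega> k s < a"
      using True bdd assms(2) by (auto simp: Theta_one cINF_less_iff)
    show "\<forall>\<^sub>F F in finite_subsets_at_top J. Theta p F \<omega> s < a"
      unfolding eventually_finite_subsets_at_top
    proof (intro exI[of _ "{k}"] conjI allI impI)
      fix F assume "finite F \<and> {k} \<subseteq> F \<and> F \<subseteq> J"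
      then have "Theta p F \<omega> s \<le> \<omega> k s"
        using assms by (intro Theta_finite_le) auto
      with k show "Theta p F \<omega> s < a" by simp
    qed (use k in auto)
  qed
next
  case False
  define a where "a j = \<omega> j s powr (- 1 / (p - 1))" for j
  have a_pos: "0 < a j" if "j \<in> J" for j
    using assms(3)[OF that] by (simp add: a_def)
  have a_nonneg: "0 \<le> a j" for j
    by (simp add: a_def)
  define S where "S = (\<Sum>\<^sub>\<infinity>j\<in>J. ennreal (a j))"
  have "((\<lambda>j. ennreal (a j)) has_sum S) J"
    unfolding S_def by (intro has_sum_infsum nonneg_summable_on_complete) simp
  moreover have "sum (\<lambda>j. ennreal (a j)) = (\<lambda>F. ennreal (\<Sum>j\<in>F. a j))"
    by (simp add: fun_eq_iff sum_ennreal a_nonneg)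
  ultimately have S: "((\<lambda>F. ennreal (\<Sum>j\<in>F. a j)) \<longlongrightarrow> S) (finite_subsets_at_top J)"
    by (simp add: has_sum_def)
  have "((\<lambda>F. (\<Sum>j\<in>F. a j) powr (1 - p)) \<longlongrightarrow> Theta p J \<omega> s) (finite_subsets_at_top J)"
  proof (cases "S = \<infinity>")
    case True
    then have "LIM F finite_subsets_at_top J. (\<Sum>j\<in>F. a j) :> at_top"
      using S by (simp add: ennreal_tendsto_top_eq_at_top)
    then have "((\<lambda>F. (\<Sum>j\<in>F. a j) powr (1 - p)) \<longlongrightarrow> 0) (finite_subsets_at_top J)"
      using assms(1) False by (intro tendsto_neg_powr) auto
    then show ?thesis
      using True False by (simp add: Theta_def Let_def S_def a_def)
  next
    case fin: False
    then obtain r where r: "S = ennreal r" "0 \<le> r"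
      by (cases S) auto
    have lim: "((\<lambda>F. \<Sum>j\<in>F. a j) \<longlongrightarrow> r) (finite_subsets_at_top J)"
      using tendsto_enn2real[OF S[unfolded r(1)] r(2)] by (simp add: sum_nonneg a_nonneg)
    obtain j where j: "j \<in> J" using assms(2) by auto
    \<comment> \<open>A single positive summand keeps the limit r away from 0, where a negative
      power is not continuous.\<close>
    have "\<forall>\<^sub>F F in finite_subsets_at_top J. a j \<le> (\<Sum>j\<in>F. a j)"
      unfolding eventually_finite_subsets_at_top using j
      by (intro exI[of _ "{j}"]) (auto intro!: member_le_sum simp: a_nonneg)
    then have "a j \<le> r"
      by (intro tendsto_lowerbound[OF lim]) auto
    then have "r \<noteq> 0"
      using a_pos[OF j] by auto
    then have "((\<lambda>F. (\<Sum>j\<in>F. a j) powr (1 - p)) \<longlongrightarrow> r powr (1 - p)) (finite_subsets_at_top J)"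
      by (intro tendsto_powr lim tendsto_const)
    moreover have "Theta p J \<omega> s = r powr (1 - p)"
      using False fin r unfolding Theta_def a_def[symmetric] S_def[symmetric] by (simp add: Let_def)
    ultimately show ?thesis
      by simp
  qed
  moreover have "\<forall>\<^sub>F F in finite_subsets_at_top J. (\<Sum>j\<in>F. a j) powr (1 - p) = Theta p F \<omega> s"
    using False by (intro eventually_finite_subsets_at_top_weakI) (simp add: Theta_finite a_def)
  ultimately show ?thesis
    by (rule Lim_transform_eventually)
qed

text \<open>Replaces the net of finite subsets by a sequence, as measurability of limits and
  dominated convergence require. Keeping k in every set makes \<omega> k a bound for all n, not just
  eventually.\<close>

lemma countable_exhaustion_finite:
  assumes "countable J" "k \<in> J"
  obtains F :: "nat \<Rightarrow> 'j set" where "\<And>n. finite (F n)" "\<And>n. F n \<subseteq> J" "\<And>n. k \<in> F n"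
    "filterlim F (finite_subsets_at_top J) sequentially"
proof
  let ?F = "\<lambda>n. insert k (from_nat_into J ` {..<n})"
  show "finite (?F n)" "k \<in> ?F n" for n
    by auto
  show sub: "?F n \<subseteq> J" for n
    using assms from_nat_into[of J] by auto
  have mem: "\<forall>\<^sub>F n in sequentially. j \<in> ?F n" if j: "j \<in> J" for j
  proof -
    obtain m where "from_nat_into J m = j"
      using from_nat_into_surj[OF assms(1) j] by auto
    then show ?thesis
      by (intro eventually_sequentiallyI[of "Suc m"]) auto
  qed
  show "filterlim ?F (finite_subsets_at_top J) sequentially"
    unfolding filterlim_iff
  proof (intro allI impI)
    fix P assume "eventually P (finite_subsets_at_top J)"
    then obtain X where X: "finite X" "X \<subseteq> J"
      "\<And>Y. finite Y \<Longrightarrow> X \<subseteq> Y \<Longrightarrow> Y \<subseteq> J \<Longrightarrow> P Y"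
      unfolding eventually_finite_subsets_at_top by auto
    have "\<forall>\<^sub>F n in sequentially. \<forall>j\<in>X. j \<in> ?F n"
      using X(1,2) mem by (intro eventually_ball_finite) auto
    then show "\<forall>\<^sub>F n in sequentially. P (?F n)"
    proof eventually_elim
      case (elim n)
      then show ?case
        using sub[of n] by (intro X(3)) auto
    qed
  qed
qed

text \<open>For p = 1 this is the indicator of all minimisers: no minimiser has to be selected, so
  measurability in s is immediate.\<close>

definition unnormalised_weight ::
  "real \<Rightarrow> 'j set \<Rightarrow> ('j \<Rightarrow> real \<Rightarrow> real) \<Rightarrow> 'j \<Rightarrow> real \<Rightarrow> real" where
  "unnormalised_weight p F \<omega> j s =
    (if p = 1 then of_bool (\<omega> j s = Theta 1 F \<omega> s) else \<omega> j s powr (- 1 / (p - 1)))"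

definition optimal_weight ::
  "real \<Rightarrow> 'j set \<Rightarrow> ('j \<Rightarrow> real \<Rightarrow> real) \<Rightarrow> 'j \<Rightarrow> real \<Rightarrow> real" where
  "optimal_weight p F \<omega> j s = (if j \<in> F
    then unnormalised_weight p F \<omega> j s / (\<Sum>k\<in>F. unnormalised_weight p F \<omega> k s) else 0)"

lemma unnormalised_weight_nonneg: "0 \<le> unnormalised_weight p F \<omega> j s"
  by (simp add: unnormalised_weight_def)

lemma optimal_weight_nonneg: "0 \<le> optimal_weight p F \<omega> j s"
  by (simp add: optimal_weight_def sum_nonneg unnormalised_weight_nonneg)

text \<open>Only p = 1 needs an argument: a finite nonempty family attains its infimum, so some
  indicator equals 1. This makes the normalisation legitimate.\<close>

lemma sum_unnormalised_weight_pos: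
  assumes "finite F" "F \<noteq> {}" "\<And>j. j \<in> F \<Longrightarrow> 0 < \<omega> j s"
  shows "0 < (\<Sum>j\<in>F. unnormalised_weight p F \<omega> j s)"
proof -
  obtain k where k: "k \<in> F" "p = 1 \<Longrightarrow> \<omega> k s = Theta 1 F \<omega> s"
  proof -
    have "Theta 1 F \<omega> s \<in> (\<lambda>j. \<omega> j s) ` F"
      using assms Min_in[of "(\<lambda>j. \<omega> j s) ` F"] by (simp add: Theta_one cInf_eq_Min)
    then show ?thesis
      using that by auto
  qed
  then have "0 < unnormalised_weight p F \<omega> k s"
    using assms(3)[of k] by (simp add: unnormalised_weight_def)
  then show ?thesis
    using assms(1) k(1) by (intro sum_pos2[of _ k]) (auto simp: unnormalised_weight_nonneg)
qed

lemma sum_optimal_weight: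
  assumes "finite F" "F \<noteq> {}" "\<And>j. j \<in> F \<Longrightarrow> 0 < \<omega> j s"
  shows "(\<Sum>j\<in>F. optimal_weight p F \<omega> j s) = 1"
  using sum_unnormalised_weight_pos[where \<omega> = \<omega> and p = p, OF assms]
  by (simp add: optimal_weight_def flip: sum_divide_distrib)

text \<open>For p > 1 put a_j = \<omega>_j^(-1/(p-1)) and S = \<Sum> a_j. Then a_j^p \<omega>_j =
  a_j, so the weights a_j / S give S / S^p = S^(1-p).\<close>

lemma sum_optimal_weight_powr:
  assumes "1 \<le> p" "finite F" "F \<noteq> {}" "\<And>j. j \<in> F \<Longrightarrow> 0 < \<omega> j s"
  shows "(\<Sum>j\<in>F. \<bar>optimal_weight p F \<omega> j s\<bar> powr p * \<omega> j s) = Theta p F \<omega> s"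
proof (cases "p = 1")
  case True
  \<comment> \<open>A nonzero weight means that j is a minimiser, so \<omega> j s may be replaced by
    the minimum in every summand.\<close>
  have "(\<Sum>j\<in>F. \<bar>optimal_weight p F \<omega> j s\<bar> powr p * \<omega> j s)
      = (\<Sum>j\<in>F. optimal_weight p F \<omega> j s * Theta p F \<omega> s)"
    using True by (intro sum.cong)
      (auto simp: optimal_weight_nonneg, auto simp: optimal_weight_def unnormalised_weight_def)
  also have "\<dots> = Theta p F \<omega> s"
    using sum_optimal_weight[where \<omega> = \<omega> and p = p, OF assms(2-4)]
    by (simp flip: sum_distrib_right)
  finally show ?thesis .
next
  case False
  define a where "a j = \<omega> j s powr (- 1 / (p - 1))" for j
  have a: "unnormalised_weight p F \<omega> j s = a j" for j
    using False by (simp add: unnormalised_weight_def a_def)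
  define S where "S = (\<Sum>j\<in>F. a j)"
  have S: "0 < S"
    using sum_unnormalised_weight_pos[where \<omega> = \<omega> and p = p, OF assms(2-4)]
    by (simp add: a S_def)
  have "\<bar>optimal_weight p F \<omega> j s\<bar> powr p * \<omega> j s = a j / S powr p" if "j \<in> F" for j
  proof -
    have "a j powr p * \<omega> j s = \<omega> j s powr (- 1 / (p - 1) * p + 1)"
      using assms(4)[OF that] unfolding powr_add by (simp add: a_def powr_powr)
    also have "- 1 / (p - 1) * p + 1 = - 1 / (p - 1)"
      using False by (simp add: field_simps)
    finally have "a j powr p * \<omega> j s = a j"
      by (simp add: a_def)
    moreover have "\<bar>optimal_weight p F \<omega> j s\<bar> powr p = a j powr p / S powr p"
      using that S by (simp add: optimal_weight_def a S_def[symmetric] powr_divide) (simp add: a_def)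
    ultimately show ?thesis
      by simp
  qed
  then have "(\<Sum>j\<in>F. \<bar>optimal_weight p F \<omega> j s\<bar> powr p * \<omega> j s) = S / S powr p"
    by (simp add: S_def sum_divide_distrib)
  also have "\<dots> = S powr (1 - p)"
    using S by (simp add: powr_diff)
  finally show ?thesis
    using False assms(2) by (simp add: Theta_finite S_def a_def)
qed

lemma optimal_weight_measurable:
  assumes "finite F" "\<And>j. j \<in> F \<Longrightarrow> \<omega> j \<in> borel_measurable M"
  shows "optimal_weight p F \<omega> j \<in> borel_measurable M"
proof (cases "j \<in> F")
  case True
  note [measurable] = Theta_measurable_finite[where p = 1, OF assms]
  have [measurable]: "unnormalised_weight p F \<omega> k \<in> borel_measurable M" if "k \<in> F" for k
  proof -
    have [measurable]: "\<omega> k \<in> borel_measurable M"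
      using assms that by auto
    have "(\<lambda>s. if p = 1 then of_bool (\<omega> k s = Theta 1 F \<omega> s) else \<omega> k s powr (- 1 / (p - 1)))
      \<in> borel_measurable M"
      by measurable
    then show ?thesis
      by (simp add: unnormalised_weight_def[abs_def])
  qed
  have "(\<lambda>s. unnormalised_weight p F \<omega> j s / (\<Sum>k\<in>F. unnormalised_weight p F \<omega> k s))
    \<in> borel_measurable M"
    using True by measurable
  then show ?thesis
    using True by (simp add: optimal_weight_def[abs_def])
qed (simp add: optimal_weight_def[abs_def])

(* The fields of class {real_normed_field, euclidean_space} are, up to isomorphism, the real
   and the complex numbers; both types are instances. *)
theorem lemma3p1:
  fixes p :: real
    and E :: "real set"
    and J :: "'j set"
    and \<omega> :: "'j \<Rightarrow> real \<Rightarrow> real"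
    and h :: "real \<Rightarrow> 'k :: {real_normed_field, euclidean_space}"
  assumes "1 \<le> p"
    and "E \<in> sets lebesgue"
    and "J \<noteq> {}" and "countable J"
    and "\<And>j. j \<in> J \<Longrightarrow> \<omega> j \<in> borel_measurable (lebesgue_on E)"
    and "\<And>j s. j \<in> J \<Longrightarrow> s \<in> E \<Longrightarrow> 0 < \<omega> j s"
    and "h \<in> borel_measurable (lebesgue_on E)"
    and "\<exists>j\<^sub>0\<in>J. integrable (lebesgue_on E) (\<lambda>s. norm (h s) powr p * \<omega> j\<^sub>0 s)"
  shows "Theta p J \<omega> \<in> borel_measurable (lebesgue_on E) \<and>
    (\<forall>\<delta>>0. \<exists>v :: 'j \<Rightarrow> real \<Rightarrow> real.
      (\<forall>j\<in>J. v j \<in> borel_measurable (lebesgue_on E)) \<and>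
      (\<forall>j\<in>J. \<forall>s\<in>E. 0 \<le> v j s) \<and>
      (\<forall>s\<in>E. ((\<lambda>j. v j s) has_sum 1) J) \<and>
      (\<integral>\<^sup>+ s. ennreal (norm (h s) powr p) *
          (\<Sum>\<^sub>\<infinity>j\<in>J. ennreal (\<bar>v j s\<bar> powr p * \<omega> j s)) \<partial>lebesgue_on E)
        \<le> (\<integral>\<^sup>+ s. ennreal (norm (h s) powr p * Theta p J \<omega> s) \<partial>lebesgue_on E) + ennreal \<delta>)"
proof -
  obtain k where k: "k \<in> J"
    and int: "integrable (lebesgue_on E) (\<lambda>s. norm (h s) powr p * \<omega> k s)"
    using assms(8) by blast
  obtain F where F: "\<And>n. finite (F n)" "\<And>n. F n \<subseteq> J" "\<And>n. k \<in> F n"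
    and F_lim: "filterlim F (finite_subsets_at_top J) sequentially"
    using countable_exhaustion_finite[OF assms(4) k] by metis
  let ?M = "lebesgue_on E"
  have space: "space ?M = E"
    by simp
  have F_pos: "0 < \<omega> j s" if "j \<in> F n" "s \<in> E" for j n s
    using assms(6) F(2) that by blast
  have F_ne: "F n \<noteq> {}" for n
    using F(3) by blast
  have Theta_n [measurable]: "Theta p (F n) \<omega> \<in> borel_measurable ?M" for n
    using assms(5) subsetD[OF F(2)] by (intro Theta_measurable_finite F(1)) blast
  have Theta_lim: "(\<lambda>n. Theta p (F n) \<omega> s) \<longlonglongrightarrow> Theta p J \<omega> s" if "s \<in> E" for s
    using filterlim_compose[OF tendsto_Theta_finite_subsets F_lim] assms that by blast
  \<comment> \<open>A pointwise limit of a sequence of measurable functions is measurable; this is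
    the first claim.\<close>
  have Theta_J [measurable]: "Theta p J \<omega> \<in> borel_measurable ?M"
    by (rule borel_measurable_LIMSEQ_real[where u = "\<lambda>n. Theta p (F n) \<omega>"]) (simp_all add: Theta_n Theta_lim)
  note [measurable] = assms(7) assms(5)[OF k]
  let ?I = "\<lambda>A. \<integral>\<^sup>+ s. ennreal (norm (h s) powr p * Theta p A \<omega> s) \<partial>?M"
  have dom: "norm (h s) powr p * Theta p (F n) \<omega> s \<le> norm (h s) powr p * \<omega> k s" if "s \<in> E" for n s
    using that F assms(1) F_pos by (intro mult_left_mono Theta_finite_le) auto
  \<comment> \<open>The hypothesis on the index k is what provides an integrable majorant for
    dominated convergence.\<close>
  have bound: "(\<integral>\<^sup>+ s. ennreal (norm (h s) powr p * \<omega> k s) \<partial>?M) < \<infinity>"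
    using integrableD(2)[OF int] F_pos[OF F(3)] assms(6)[OF k]
    by (simp add: less_top real_integrable_def)
  have I_lim: "(\<lambda>n. ?I (F n)) \<longlonglongrightarrow> ?I J"
  proof (rule nn_integral_dominated_convergence[OF _ _ _ _ bound])
    show "AE s in ?M. ennreal (norm (h s) powr p * Theta p (F n) \<omega> s)
        \<le> ennreal (norm (h s) powr p * \<omega> k s)" for n
      using dom by (intro AE_I2 ennreal_leI) auto
    show "AE s in ?M. (\<lambda>n. ennreal (norm (h s) powr p * Theta p (F n) \<omega> s))
        \<longlonglongrightarrow> ennreal (norm (h s) powr p * Theta p J \<omega> s)"
      using Theta_lim by (intro AE_I2 tendsto_ennrealI tendsto_mult_left) auto
  qed measurable
  \<comment> \<open>The majorant also bounds the limit integral. Its finiteness makes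
    \<open>?I J < ?I J + ennreal \<delta>\<close> strict, so that convergence yields a suitable
    n.\<close>
  have "?I (F n) \<le> (\<integral>\<^sup>+ s. ennreal (norm (h s) powr p * \<omega> k s) \<partial>?M)" for n
    using dom by (intro nn_integral_mono ennreal_leI) auto
  then have I_fin: "?I J < \<infinity>"
    using Lim_bounded[OF I_lim] bound by (meson le_less_trans)
  show ?thesis
  proof (intro conjI allI impI Theta_J)
    fix \<delta> :: real assume "0 < \<delta>"
    then have "?I J < ?I J + ennreal \<delta>"
      using I_fin by (cases "?I J") (auto simp: ennreal_less_iff simp flip: ennreal_plus)
    then have "\<forall>\<^sub>F n in sequentially. ?I (F n) < ?I J + ennreal \<delta>"
      by (rule order_tendstoD(2)[OF I_lim])
    then obtain n where n: "?I (F n) < ?I J + ennreal \<delta>"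
      using eventually_happens by fastforce
    let ?v = "optimal_weight p (F n) \<omega>"
    have v_zero: "?v j s = 0" if "j \<notin> F n" for j s
      using that by (simp add: optimal_weight_def)
    \<comment> \<open>The weights vanish off \<open>F n\<close>, so the sum over J is a finite one,
      whose value is \<open>Theta p (F n) \<omega> s\<close> exactly. The only loss is thus the
      passage from J to \<open>F n\<close>.\<close>
    have "ennreal (norm (h s) powr p) * (\<Sum>\<^sub>\<infinity>j\<in>J. ennreal (\<bar>?v j s\<bar> powr p * \<omega> j s))
        = ennreal (norm (h s) powr p * Theta p (F n) \<omega> s)" if s: "s \<in> E" for s
    proof -
      have "(\<Sum>\<^sub>\<infinity>j\<in>J. ennreal (\<bar>?v j s\<bar> powr p * \<omega> j s))
          = (\<Sum>\<^sub>\<infinity>j\<in>F n. ennreal (\<bar>?v j s\<bar> powr p * \<omega> j s))"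
        using F(2)[of n] by (intro infsum_cong_neutral) (auto simp: v_zero)
      also have "\<dots> = ennreal (\<Sum>j\<in>F n. \<bar>?v j s\<bar> powr p * \<omega> j s)"
        using F(1)[of n] F_pos[OF _ s] by (simp add: sum_ennreal less_imp_le)
      also have "\<dots> = ennreal (Theta p (F n) \<omega> s)"
        using sum_optimal_weight_powr[where \<omega> = \<omega> and s = s, OF assms(1) F(1) F_ne F_pos[OF _ s]]
        by simp
      finally show ?thesis
        by (simp add: ennreal_mult Theta_nonneg F_ne F_pos[OF _ s])
    qed
    then have "(\<integral>\<^sup>+ s. ennreal (norm (h s) powr p) *
        (\<Sum>\<^sub>\<infinity>j\<in>J. ennreal (\<bar>?v j s\<bar> powr p * \<omega> j s)) \<partial>?M) = ?I (F n)"
      by (intro nn_integral_cong) simp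
    moreover have "((\<lambda>j. ?v j s) has_sum 1) J" if s: "s \<in> E" for s
    proof -
      have "((\<lambda>j. ?v j s) has_sum 1) (F n)"
        using F(1) sum_optimal_weight[where \<omega> = \<omega> and s = s, OF F(1) F_ne F_pos[OF _ s]]
        by (intro has_sum_finiteI) auto
      then show ?thesis
        using F(2)[of n]
        by (subst has_sum_cong_neutral[where T = "F n" and g = "\<lambda>j. ?v j s"]) (auto simp: v_zero)
    qed
    moreover have "?v j \<in> borel_measurable ?M" for j
      using assms(5) subsetD[OF F(2)] by (intro optimal_weight_measurable F(1)) blast
    ultimately show "\<exists>v :: 'j \<Rightarrow> real \<Rightarrow> real.
      (\<forall>j\<in>J. v j \<in> borel_measurable ?M) \<and>
      (\<forall>j\<in>J. \<forall>s\<in>E. 0 \<le> v j s) \<and>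
      (\<forall>s\<in>E. ((\<lambda>j. v j s) has_sum 1) J) \<and>
      (\<integral>\<^sup>+ s. ennreal (norm (h s) powr p) *
          (\<Sum>\<^sub>\<infinity>j\<in>J. ennreal (\<bar>v j s\<bar> powr p * \<omega> j s)) \<partial>?M) \<le> ?I J + ennreal \<delta>"
      using n by (intro exI[of _ ?v]) (auto simp: optimal_weight_nonneg)
  qed
qed

end
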